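(* Let $X$ and $Y$ be graphs, and suppose the tensor product $X\times Y$ admits perfect state transfer between vertices $(w,u)$ and $(z,v)$ (with $w,z\in V(X)$, $u,v\in V(Y)$). If $u=v$, then $Y$ is periodic at $u$; if $u\neq v$, then $Y$ admits perfect state transfer between $u$ and $v$. Likewise, if $w=z$, then $X$ is periodic at $w$; if $w\neq z$, then $X$ admits perfect state transfer between $w$ and $z$.
   Context: Graphs are simple and undirected with adjacency matrix $A(\cdot)$. The tensor product $X\times Y$ is the graph on $V(X)\times V(Y)$ with adjacency matrix $A(X)\otimes A(Y)$. For a graph $G$, $U_G(t)=\exp(\mathrm{i}tA(G))$. $G$ admits perfect state transfer from $u$ to a distinct vertex $v$ if there are $\tau>0$ and $\lambda\in\mathbb{C}$ with $U_G(\tau)\mathbf{e}_u=\lambda\mathbf{e}_v$, where $\mathbf{e}_u$ is the characteristic vector of $u$; $G$ is periodic at $u$ if there are $\tau\neq0$ and $\lambda$ with $U_G(\tau)\mathbf{e}_u=\lambda\mathbf{e}_u$. *)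

theory Defs
  imports "HOL-Analysis.Analysis"
begin

text \<open>
  A graph is its adjacency relation on a finite type; the type is the vertex set.
\<close>

definition simple_graph :: "('a::finite \<Rightarrow> 'a \<Rightarrow> bool) \<Rightarrow> bool" where
  "simple_graph G \<longleftrightarrow> irreflp G \<and> symp G"

definition adjacency_matrix :: "('a::finite \<Rightarrow> 'a \<Rightarrow> bool) \<Rightarrow> complex^'a^'a" where
  "adjacency_matrix G = (\<chi> x y. of_bool (G x y))"

definition kronecker_product ::
    "complex^'a^'a \<Rightarrow> complex^'b^'b \<Rightarrow> complex^('a::finite \<times> 'b::finite)^('a \<times> 'b)" where
  "kronecker_product A B = (\<chi> p q. A $ fst p $ fst q * B $ snd p $ snd q)"

definition tensor_product ::
    "('a::finite \<Rightarrow> 'a \<Rightarrow> bool) \<Rightarrow> ('b::finite \<Rightarrow> 'b \<Rightarrow> bool) \<Rightarrow> 'a \<times> 'b \<Rightarrow> 'a \<times> 'b \<Rightarrow> bool" where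
  "tensor_product X Y p q \<longleftrightarrow> X (fst p) (fst q) \<and> Y (snd p) (snd q)"

lemma adjacency_matrix_inject: "adjacency_matrix G = adjacency_matrix H \<longleftrightarrow> G = H"
  by (auto simp: adjacency_matrix_def vec_eq_iff fun_eq_iff)

lemma adjacency_matrix_tensor_product:
  "adjacency_matrix (tensor_product X Y) =
     kronecker_product (adjacency_matrix X) (adjacency_matrix Y)"
  by (simp add: adjacency_matrix_def kronecker_product_def tensor_product_def vec_eq_iff)

lemma simple_graph_tensor_product:
  "simple_graph X \<Longrightarrow> simple_graph Y \<Longrightarrow> simple_graph (tensor_product X Y)"
  by (auto simp: simple_graph_def tensor_product_def irreflp_def symp_def)

text \<open>
  Multiplication and powers inherited by the type of matrices from its entries act
  componentwise, so powers with respect to the matrix product are iterated explicitly.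
\<close>

definition matrix_power :: "complex^'n^'n \<Rightarrow> nat \<Rightarrow> complex^'n^'n" where
  "matrix_power A k = (((**) A) ^^ k) (mat 1)"

definition matrix_exp :: "complex^'n^'n \<Rightarrow> complex^'n^'n" where
  "matrix_exp A = (\<Sum>k. (1 / fact k) *\<^sub>R matrix_power A k)"

lemma summable_matrix_exp:
  fixes A :: "complex^'n^'n"
  shows "summable (\<lambda>k. (1 / fact k) *\<^sub>R matrix_power A k)"
proof -
  define M where "M = (\<Sum>i\<in>UNIV. \<Sum>j\<in>UNIV. norm (A $ i $ j))"
  have M: "norm (A $ i $ j) \<le> M" for i j
  proof -
    have "norm (A $ i $ j) \<le> (\<Sum>j\<in>UNIV. norm (A $ i $ j))"
      by (rule member_le_sum) auto
    also have "\<dots> \<le> M"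
      unfolding M_def by (rule member_le_sum) (auto intro: sum_nonneg)
    finally show ?thesis .
  qed
  have M0: "0 \<le> M"
    by (rule order_trans[OF norm_ge_zero M])
  define c where "c = real CARD('n)"
  have entry: "norm (matrix_power A k $ i $ j) \<le> (c * M) ^ k" for k i j
  proof (induction k arbitrary: i)
    case 0
    show ?case by (simp add: matrix_power_def mat_def)
  next
    case (Suc k)
    have "norm (matrix_power A (Suc k) $ i $ j) =
        norm (\<Sum>l\<in>UNIV. A $ i $ l * matrix_power A k $ l $ j)"
      by (simp add: matrix_power_def matrix_matrix_mult_def)
    also have "\<dots> \<le> (\<Sum>l\<in>(UNIV :: 'n set). M * (c * M) ^ k)"
      by (rule sum_norm_le) (auto simp: norm_mult intro!: mult_mono M Suc M0)
    also have "\<dots> = (c * M) ^ Suc k"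
      by (simp add: c_def)
    finally show ?case .
  qed
  have "norm (matrix_power A k) \<le> c * (c * (c * M) ^ k)" for k
  proof -
    have "norm (matrix_power A k) \<le> (\<Sum>i\<in>UNIV. norm (matrix_power A k $ i))"
      by (simp add: norm_vec_def L2_set_le_sum)
    also have "\<dots> \<le> (\<Sum>i\<in>UNIV. \<Sum>j\<in>UNIV. norm (matrix_power A k $ i $ j))"
      by (rule sum_mono) (simp add: norm_vec_def[of "_ $ _"] L2_set_le_sum)
    also have "\<dots> \<le> (\<Sum>i\<in>(UNIV :: 'n set). \<Sum>j\<in>(UNIV :: 'n set). (c * M) ^ k)"
      by (intro sum_mono entry)
    finally show ?thesis by (simp add: c_def)
  qed
  then have bound: "norm ((1 / fact k) *\<^sub>R matrix_power A k) \<le> c * c * ((c * M) ^ k /\<^sub>R fact k)" for k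
    by (simp add: divide_simps mult_ac)
  show ?thesis
    by (rule summable_comparison_test'[OF summable_mult[OF summable_exp_generic] bound])
qed

definition transition_matrix :: "('a::finite \<Rightarrow> 'a \<Rightarrow> bool) \<Rightarrow> real \<Rightarrow> complex^'a^'a" where
  "transition_matrix G t = matrix_exp (\<chi> x y. \<i> * of_real t * adjacency_matrix G $ x $ y)"

definition perfect_state_transfer :: "('a::finite \<Rightarrow> 'a \<Rightarrow> bool) \<Rightarrow> 'a \<Rightarrow> 'a \<Rightarrow> bool" where
  "perfect_state_transfer G u v \<longleftrightarrow>
     u \<noteq> v \<and> (\<exists>\<tau> > 0. \<exists>c. transition_matrix G \<tau> *v axis u 1 = c *s axis v 1)"

definition periodic_at :: "('a::finite \<Rightarrow> 'a \<Rightarrow> bool) \<Rightarrow> 'a \<Rightarrow> bool" where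
  "periodic_at G u \<longleftrightarrow>
     (\<exists>\<tau>. \<tau> \<noteq> 0 \<and> (\<exists>c. transition_matrix G \<tau> *v axis u 1 = c *s axis u 1))"

end

theory Submission
  imports Defs
begin

text \<open>
  Let \<open>x\<close> be a real eigenvector of \<open>A(X)\<close> for an eigenvalue \<open>\<theta>\<close>. Contracting the first tensor
  factor against \<open>x\<close> intertwines \<open>A(X) \<otimes> A(Y)\<close> with \<open>\<theta> A(Y)\<close>, so it turns state transfer on
  \<open>X \<times> Y\<close> at time \<open>\<tau>\<close> into \<open>x\<^sub>w U\<^sub>Y(\<theta>\<tau>) e\<^sub>u = \<lambda> x\<^sub>z e\<^sub>v\<close>. An eigenvector with \<open>\<theta> \<noteq> 0\<close> and \<open>x\<^sub>w \<noteq> 0\<close>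
  exists unless \<open>A(X) e\<^sub>w = 0\<close>, which would make \<open>(w, u)\<close> isolated and hence fixed by the walk.
  A negative time is made positive by complex conjugation, as \<open>A(Y)\<close> is real.
\<close>

subsection \<open>Eigenvectors of self-adjoint operators\<close>

text \<open>Near \<open>t = 0\<close> the linear term dominates, so a nonzero \<open>b\<close> would
  give negative values on one side.\<close>

lemma real_quadratic_nonneg_imp_linear_coeff_zero:
  fixes b c :: real
  assumes "\<And>t. 0 \<le> t * b + t\<^sup>2 * c"
  shows "b = 0"
proof (rule ccontr)
  assume "b \<noteq> 0"
  \<comment> \<open>The step against the sign of \<open>b\<close> is short enough that the quadratic
    term cannot compensate: the value has numerator at most \<open>- b\<^sup>2\<close>. The
    \<open>+ 1\<close> keeps the denominator positive when \<open>c = 0\<close>.\<close>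
  define t where "t = - b / (\<bar>c\<bar> + 1)"
  have "t * b + t\<^sup>2 * c = b\<^sup>2 * (c - \<bar>c\<bar> - 1) / (\<bar>c\<bar> + 1)\<^sup>2"
    unfolding t_def by (simp add: divide_simps power2_eq_square) (simp add: algebra_simps)
  also have "\<dots> < 0"
    using \<open>b \<noteq> 0\<close> by (intro divide_neg_pos mult_pos_neg) auto
  finally show False
    using assms[of t] by simp
qed

text \<open>The eigenvector is a maximiser of the Rayleigh quotient on the unit sphere of \<open>S\<close>.\<close>

lemma self_adjoint_eigenvector_in_subspace:
  fixes f :: "'n::euclidean_space \<Rightarrow> 'n"
  assumes lin: "linear f" and adj: "\<And>x y. f x \<bullet> y = x \<bullet> f y"
    and S: "subspace S" and inv: "f ` S \<subseteq> S" and y: "y \<in> S" "y \<noteq> 0"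
  obtains x \<theta> where "x \<in> S" "x \<noteq> 0" "f x = \<theta> *\<^sub>R x"
proof -
  interpret linear f by fact
  have "compact (S \<inter> sphere 0 1)"
    by (simp add: closed_Int_compact closed_subspace S)
  moreover have "(1 / norm y) *\<^sub>R y \<in> S \<inter> sphere 0 1"
    using y S by (simp add: subspace_scale)
  moreover have "continuous_on (S \<inter> sphere 0 1) (\<lambda>x. f x \<bullet> x)"
    using lin by (intro continuous_on_inner linear_continuous_on continuous_on_id)
      (simp add: linear_conv_bounded_linear)
  ultimately obtain x where x: "x \<in> S" "norm x = 1"
    and max: "\<And>z. z \<in> S \<Longrightarrow> norm z = 1 \<Longrightarrow> f z \<bullet> z \<le> f x \<bullet> x"
    using continuous_attains_sup[of "S \<inter> sphere 0 1" "\<lambda>x. f x \<bullet> x"] by fastforce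
  define \<theta> where "\<theta> = f x \<bullet> x"
  \<comment> \<open>By homogeneity, maximality on the unit sphere extends to all of
    \<open>S\<close>.\<close>
  have rayleigh: "f z \<bullet> z \<le> \<theta> * (z \<bullet> z)" if "z \<in> S" for z
  proof (cases "z = 0")
    case False
    define a where "a = 1 / norm z"
    have "f (a *\<^sub>R z) \<bullet> (a *\<^sub>R z) \<le> \<theta>"
      unfolding \<theta>_def using that False S by (intro max) (auto simp: a_def subspace_scale)
    then show ?thesis
      using False by (simp add: scale a_def divide_simps dot_square_norm power2_eq_square)
  qed (simp add: zero)
  \<comment> \<open>The residual \<open>d\<close> is an admissible direction of variation since
    \<open>S\<close> is invariant. First-order optimality in this direction will force
    \<open>d \<bullet> d = 0\<close>.\<close>
  define d where "d = f x - \<theta> *\<^sub>R x"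
  have d: "d \<in> S"
    unfolding d_def using x S inv by (auto intro!: subspace_diff subspace_scale)
  have xx: "x \<bullet> x = 1"
    using x by (simp add: dot_square_norm)
  have sym: "f d \<bullet> x = f x \<bullet> d"
    by (subst adj) (rule inner_commute)
  have dd: "f x \<bullet> d - \<theta> * (x \<bullet> d) = d \<bullet> d"
    by (metis d_def inner_diff_left inner_scaleR_left)
  \<comment> \<open>This is the Rayleigh bound at \<open>x + t *\<^sub>R d\<close>: the constant
    terms cancel because \<open>x\<close> is a unit vector, and \<open>dd\<close> turns the linear
    coefficient into \<open>- 2 * (d \<bullet> d)\<close>.\<close>
  have "0 \<le> t * (- 2 * (d \<bullet> d)) + t\<^sup>2 * (\<theta> * (d \<bullet> d) - f d \<bullet> d)" for t
  proof -
    have "f (x + t *\<^sub>R d) \<bullet> (x + t *\<^sub>R d) \<le> \<theta> * ((x + t *\<^sub>R d) \<bullet> (x + t *\<^sub>R d))"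
      using x d S by (intro rayleigh) (auto intro: subspace_add subspace_scale)
    then have "\<theta> + 2 * t * (f x \<bullet> d) + t\<^sup>2 * (f d \<bullet> d)
        \<le> \<theta> * (1 + 2 * t * (x \<bullet> d) + t\<^sup>2 * (d \<bullet> d))"
      by (simp add: add scale inner_add_left inner_add_right sym xx inner_commute[of d x]
          flip: \<theta>_def) (simp add: algebra_simps power2_eq_square)
    then show ?thesis
      unfolding dd[symmetric] by (simp add: algebra_simps)
  qed
  then have "- 2 * (d \<bullet> d) = 0"
    by (rule real_quadratic_nonneg_imp_linear_coeff_zero)
  then have "f x = \<theta> *\<^sub>R x"
    by (simp add: d_def)
  moreover have "x \<noteq> 0"
    using x by auto
  ultimately show ?thesis
    using that x by blast
qed

text \<open>The eigenvector is taken inside the invariant subspace generated by the iterates of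
  \<open>f\<close> on \<open>e\<close>. If \<open>\<theta> = 0\<close> or
  \<open>x \<bullet> e = 0\<close>, it would be orthogonal to every generator, hence to
  itself.\<close>

lemma self_adjoint_eigenvector_not_orthogonal:
  fixes f :: "'n::euclidean_space \<Rightarrow> 'n"
  assumes lin: "linear f" and adj: "\<And>x y. f x \<bullet> y = x \<bullet> f y" and e: "f e \<noteq> 0"
  obtains x \<theta> where "\<theta> \<noteq> 0" "f x = \<theta> *\<^sub>R x" "x \<bullet> e \<noteq> 0"
proof -
  \<comment> \<open>The iterates start at \<open>f e\<close>, not at \<open>e\<close>: each inner
    product with \<open>x\<close> then carries a factor \<open>\<theta>\<close>, which excludes the
    eigenvalue 0 as well.\<close>
  define B where "B = range (\<lambda>k. (f ^^ Suc k) e)"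
  have "f ` B \<subseteq> B"
    by (force simp: B_def intro: range_eqI[of _ _ "Suc _"])
  then have "f ` span B \<subseteq> span B"
    by (metis linear_span_image[OF lin] span_mono)
  moreover have "f e \<in> span B"
    by (rule span_base) (auto simp: B_def intro!: range_eqI[of _ _ 0])
  ultimately obtain x \<theta> where x: "x \<in> span B" "x \<noteq> 0" "f x = \<theta> *\<^sub>R x"
    using self_adjoint_eigenvector_in_subspace[OF lin adj subspace_span] e by metis
  have power: "x \<bullet> (f ^^ k) e = \<theta> ^ k * (x \<bullet> e)" for k
    by (induction k) (simp_all add: x(3) flip: adj)
  have "\<theta> * (x \<bullet> e) \<noteq> 0"
  proof
    assume "\<theta> * (x \<bullet> e) = 0"
    then have "orthogonal x b" if "b \<in> B" for b
      using that power[of "Suc _"] by (auto simp: B_def orthogonal_def simp del: funpow.simps)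
    then have "orthogonal x x"
      using orthogonal_to_span x(1) by blast
    then show False
      using x(2) by (simp add: orthogonal_self)
  qed
  then show ?thesis
    using that x(3) by auto
qed

subsection \<open>The matrix exponential\<close>

lemma matrix_power_intertwine:
  fixes P :: "complex^'m^'n"
  assumes "P ** M = N ** P"
  shows "P ** matrix_power M k = matrix_power N k ** P"
  by (induction k) (simp_all add: matrix_power_def, metis assms matrix_mul_assoc)

lemma matrix_vector_mult_axis_nth:
  fixes A :: "'c::semiring_1^'m^'n"
  shows "(A *v axis k 1) $ i = A $ i $ k"
  by (simp add: matrix_vector_mult_def axis_def if_distrib cong: if_cong)

lemma scaleR_matrix_vector_mult:
  fixes M :: "complex^'m^'n"
  shows "(r *\<^sub>R M) *v y = r *\<^sub>R (M *v y)"
  by (simp add: vec_eq_iff matrix_vector_mult_def scaleR_sum_right)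

lemma scaleR_matrix_mult_left:
  fixes M :: "complex^'m^'n"
  shows "(r *\<^sub>R M) ** N = r *\<^sub>R (M ** N)"
  by (simp add: vec_eq_iff matrix_matrix_mult_def scaleR_sum_right)

lemma scaleR_matrix_mult_right:
  fixes M :: "complex^'m^'n"
  shows "M ** (r *\<^sub>R N) = r *\<^sub>R (M ** N)"
  by (simp add: vec_eq_iff matrix_matrix_mult_def scaleR_sum_right)

text \<open>The relation passes to powers and then termwise through the series. \<open>P\<close> may
  be rectangular, as needed for contracting a tensor factor.\<close>

lemma matrix_exp_intertwine:
  fixes P :: "complex^'m^'n"
  assumes "P ** M = N ** P"
  shows "P ** matrix_exp M = matrix_exp N ** P"
proof -
  have left: "bounded_linear (\<lambda>L. P ** L :: complex^'m^'n)"
    by (intro linear_conv_bounded_linear[THEN iffD1] linearI)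
      (simp_all add: matrix_add_ldistrib scaleR_matrix_mult_right)
  have right: "bounded_linear (\<lambda>L. L ** P :: complex^'m^'n)"
    by (intro linear_conv_bounded_linear[THEN iffD1] linearI)
      (simp_all add: vec_eq_iff matrix_matrix_mult_def algebra_simps sum.distrib scaleR_sum_right)
  show ?thesis
    unfolding matrix_exp_def
    by (simp add: bounded_linear.suminf[OF left summable_matrix_exp]
        bounded_linear.suminf[OF right summable_matrix_exp]
        scaleR_matrix_mult_left scaleR_matrix_mult_right matrix_power_intertwine[OF assms])
qed

lemma matrix_exp_kernel:
  assumes "M *v y = 0"
  shows "matrix_exp M *v y = y"
proof -
  have bl: "bounded_linear (\<lambda>L. L *v y)"
    by (intro linear_conv_bounded_linear[THEN iffD1] linearI)
      (simp_all add: matrix_vector_mult_add_rdistrib scaleR_matrix_vector_mult)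
  have "matrix_power M k *v y = (if k = 0 then y else 0)" for k
  proof (cases k)
    case (Suc l)
    \<comment> \<open>\<open>matrix_power\<close> multiplies on the left; intertwining
      \<open>M\<close> with itself moves one factor to the right, where it kills
      \<open>y\<close>.\<close>
    have "matrix_power M k = matrix_power M l ** M"
      using matrix_power_intertwine[of M M M l] Suc by (simp add: matrix_power_def)
    then show ?thesis
      using Suc assms by (simp flip: matrix_vector_mul_assoc)
  qed (simp add: matrix_power_def)
  then have "(\<lambda>k. ((1 / fact k) *\<^sub>R matrix_power M k) *v y) = (\<lambda>k. if k = 0 then y else 0)"
    by (auto simp: fun_eq_iff scaleR_matrix_vector_mult)
  then show ?thesis
    unfolding matrix_exp_def bounded_linear.suminf[OF bl summable_matrix_exp]
    using sums_unique[OF sums_single[of 0 "\<lambda>_. y"]] by simp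
qed

text \<open>Entrywise conjugation respects matrix products and is real-linear, which suffices
  because the series has real coefficients.\<close>

lemma matrix_exp_cnj:
  "matrix_exp (\<chi> i j. cnj (M $ i $ j)) = (\<chi> i j. cnj (matrix_exp M $ i $ j))"
proof -
  let ?C = "\<lambda>L::complex^'n^'n. \<chi> i j. cnj (L $ i $ j)"
  have bl: "bounded_linear ?C"
    by (intro linear_conv_bounded_linear[THEN iffD1] linearI) (simp_all add: vec_eq_iff)
  have power: "?C (matrix_power M k) = matrix_power (?C M) k" for k
    by (induction k)
      (simp_all add: matrix_power_def vec_eq_iff mat_def matrix_matrix_mult_def)
  have scale: "?C (r *\<^sub>R L) = r *\<^sub>R ?C L" for r and L :: "complex^'n^'n"
    by (simp add: vec_eq_iff)
  show ?thesis
    unfolding matrix_exp_def bounded_linear.suminf[OF bl summable_matrix_exp] scale power ..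
qed

subsection \<open>Quantum walks on graphs\<close>

text \<open>The two separate times allow an eigenvalue to be absorbed into the time of one of the
  walks.\<close>

lemma transition_matrix_intertwine:
  fixes P :: "complex^'a::finite^'b::finite"
  assumes "\<And>b a. s * (P ** adjacency_matrix G) $ b $ a = t * (adjacency_matrix H ** P) $ b $ a"
  shows "P ** transition_matrix G s = transition_matrix H t ** P"
  unfolding transition_matrix_def
proof (rule matrix_exp_intertwine)
  show "P ** (\<chi> x y. \<i> * complex_of_real s * adjacency_matrix G $ x $ y) =
      (\<chi> x y. \<i> * complex_of_real t * adjacency_matrix H $ x $ y) ** P" (is "?L = ?R")
  proof -
    have "?L $ b $ a = \<i> * (s * (P ** adjacency_matrix G) $ b $ a)" for a b
      by (simp add: matrix_matrix_mult_def sum_distrib_left mult_ac)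
    moreover have "?R $ b $ a = \<i> * (t * (adjacency_matrix H ** P) $ b $ a)" for a b
      by (simp add: matrix_matrix_mult_def sum_distrib_left mult_ac)
    ultimately show ?thesis
      using assms by (simp add: vec_eq_iff)
  qed
qed

lemma transition_matrix_isolated:
  assumes "\<And>x. \<not> G x a"
  shows "transition_matrix G t *v axis a 1 = axis a 1"
  unfolding transition_matrix_def
  by (rule matrix_exp_kernel)
    (simp add: vec_eq_iff matrix_vector_mult_axis_nth adjacency_matrix_def assms)

lemma transition_matrix_uminus:
  "transition_matrix G (- t) = (\<chi> x y. cnj (transition_matrix G t $ x $ y))"
  unfolding transition_matrix_def matrix_exp_cnj[symmetric]
  by (rule arg_cong[of _ _ matrix_exp]) (simp add: vec_eq_iff adjacency_matrix_def)

lemma transition_matrix_uminus_axis: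
  assumes "transition_matrix G t *v axis u 1 = c *s axis v 1"
  shows "transition_matrix G (- t) *v axis u 1 = cnj c *s axis v 1"
proof -
  have "transition_matrix G t $ i $ u = c * axis v 1 $ i" for i
    using assms by (auto simp: vec_eq_iff matrix_vector_mult_axis_nth)
  then show ?thesis
    by (simp add: vec_eq_iff matrix_vector_mult_axis_nth transition_matrix_uminus) (simp add: axis_def)
qed

text \<open>The time obtained by contraction has the sign of an eigenvalue. Periodicity accepts any
  nonzero time; for transfer a negative time is reversed by conjugation.\<close>

lemma state_transfer_cases:
  assumes "t \<noteq> 0" and t: "transition_matrix G t *v axis u 1 = c *s axis v 1"
  shows "(u = v \<longrightarrow> periodic_at G u) \<and> (u \<noteq> v \<longrightarrow> perfect_state_transfer G u v)"
proof -
  have "\<exists>\<tau>>0. \<exists>c. transition_matrix G \<tau> *v axis u 1 = c *s axis v 1"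
  proof (cases "t > 0")
    case False
    then show ?thesis
      using transition_matrix_uminus_axis[OF t] \<open>t \<noteq> 0\<close>
      by (intro exI[of _ "- t"]) auto
  qed (use t in blast)
  then show ?thesis
    unfolding periodic_at_def perfect_state_transfer_def using assms by blast
qed

text \<open>The permutation matrix \<open>P\<close> exchanging the coordinates intertwines the two
  walks. This reduces the claims about the first factor to those about the second.\<close>

lemma perfect_state_transfer_tensor_product_swap:
  assumes "perfect_state_transfer (tensor_product X Y) (w, u) (z, v)"
  shows "perfect_state_transfer (tensor_product Y X) (u, w) (v, z)"
proof -
  define P :: "complex^('a \<times> 'b)^('b \<times> 'a)" where
    "P = (\<chi> p q. of_bool (q = prod.swap p))"
  have P_axis: "P *v axis (a, b) 1 = axis (b, a) 1" for a b
    by (simp add: P_def vec_eq_iff matrix_vector_mult_axis_nth) (auto simp: axis_def)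
  have swap: "q = prod.swap p \<longleftrightarrow> p = prod.swap q" for p :: "'b \<times> 'a" and q
    by auto
  have P_left: "(P ** M) $ p $ q = M $ prod.swap p $ q" for M :: "complex^('a \<times> 'b)^('a \<times> 'b)" and p q
    by (simp add: P_def matrix_matrix_mult_def of_bool_def if_distrib if_distribR cong: if_cong)
  have P_right: "(M ** P) $ p $ q = M $ p $ prod.swap q" for M :: "complex^('b \<times> 'a)^('b \<times> 'a)" and p q
    by (simp add: P_def matrix_matrix_mult_def swap of_bool_def if_distrib if_distribR cong: if_cong)
  have "P ** transition_matrix (tensor_product X Y) t =
      transition_matrix (tensor_product Y X) t ** P" for t
    by (rule transition_matrix_intertwine)
      (auto simp: P_left P_right adjacency_matrix_def tensor_product_def of_bool_def)
  then have "transition_matrix (tensor_product Y X) t *v axis (u, w) 1 =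
      P *v (transition_matrix (tensor_product X Y) t *v axis (w, u) 1)" for t
    by (simp add: matrix_vector_mul_assoc flip: P_axis)
  then have "transition_matrix (tensor_product Y X) t *v axis (u, w) 1 = c *s axis (v, z) 1"
    if "transition_matrix (tensor_product X Y) t *v axis (w, u) 1 = c *s axis (z, v) 1" for t c
    by (simp add: that vector_scalar_commute P_axis)
  then show ?thesis
    using assms unfolding perfect_state_transfer_def by blast
qed

lemma tensor_product_state_transfer_right:
  fixes X :: "'a::finite \<Rightarrow> 'a \<Rightarrow> bool" and Y :: "'b::finite \<Rightarrow> 'b \<Rightarrow> bool"
  assumes X: "simple_graph X"
    and pst: "perfect_state_transfer (tensor_product X Y) (w, u) (z, v)"
  shows "(u = v \<longrightarrow> periodic_at Y u) \<and> (u \<noteq> v \<longrightarrow> perfect_state_transfer Y u v)"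
proof -
  obtain \<tau> c where neq: "(w, u) \<noteq> (z, v)" and "\<tau> > 0"
    and \<tau>: "transition_matrix (tensor_product X Y) \<tau> *v axis (w, u) 1 = c *s axis (z, v) 1"
    using pst by (auto simp: perfect_state_transfer_def)
  have X_sym: "X a b = X b a" for a b
    using X by (auto simp: simple_graph_def symp_def)
  \<comment> \<open>A real copy of the adjacency matrix makes the self-adjoint eigenvector result on
    a real Euclidean space applicable.\<close>
  define A :: "real^'a^'a" where "A = (\<chi> a b. of_bool (X a b))"
  have "\<exists>a. X a w"
  proof (rule ccontr)
    assume "\<nexists>a. X a w"
    then have "axis (w, u) 1 = c *s axis (z, v) 1"
      using \<tau> by (simp add: transition_matrix_isolated tensor_product_def)
    \<comment> \<open>At the entry \<open>(w, u)\<close> the left side is 1 and the right side is 0,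
      as the two vertices differ.\<close>
    from arg_cong[OF this, of "\<lambda>x. x $ (w, u)"] show False
      using neq by (simp add: axis_def split: if_splits)
  qed
  then have nonzero: "A *v axis w 1 \<noteq> 0"
    by (auto simp: A_def vec_eq_iff matrix_vector_mult_axis_nth)
  have "transpose A = A"
    by (simp add: A_def transpose_def vec_eq_iff X_sym)
  then have adj: "(A *v x) \<bullet> y = x \<bullet> (A *v y)" for x y
    by (metis dot_lmul_matrix vector_transpose_matrix)
  obtain x \<theta> where "\<theta> \<noteq> 0" and eigen: "A *v x = \<theta> *\<^sub>R x" and "x \<bullet> axis w 1 \<noteq> 0"
    using self_adjoint_eigenvector_not_orthogonal[OF matrix_vector_mul_linear adj nonzero] .
  then have xw: "x $ w \<noteq> 0"
    by (simp add: inner_axis)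
  \<comment> \<open>This is the Kronecker product of the row vector \<open>x\<close> with the
    identity on the second factor, so it contracts the first factor against
    \<open>x\<close>.\<close>
  define P :: "complex^('a \<times> 'b)^'b" where
    "P = (\<chi> b q. of_real (x $ fst q) * of_bool (b = snd q))"
  have P_axis: "P *v axis (a, b) 1 = of_real (x $ a) *s axis b 1" for a b
    by (simp add: P_def vec_eq_iff matrix_vector_mult_axis_nth) (auto simp: axis_def)
  \<comment> \<open>\<open>P\<close> multiplies the adjacency matrix from the left, so the
    eigenvalue equation is needed for \<open>x\<close> as a row vector; symmetry of \<open>X\<close>
    provides it.\<close>
  have eigen_entry: "(\<Sum>a'\<in>UNIV. complex_of_real (x $ a') * of_bool (X a' a)) = \<theta> * x $ a" for a
  proof -
    have "(\<Sum>a'\<in>UNIV. x $ a' * of_bool (X a' a)) = (A *v x) $ a"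
      unfolding A_def matrix_vector_mult_def vec_lambda_beta
      by (rule sum.cong) (simp_all add: X_sym mult.commute)
    also have "\<dots> = \<theta> * x $ a"
      by (simp add: eigen)
    finally have "(\<Sum>a'\<in>UNIV. x $ a' * of_bool (X a' a)) = \<theta> * x $ a" .
    from arg_cong[OF this, of complex_of_real] show ?thesis
      by simp
  qed
  have "P ** transition_matrix (tensor_product X Y) \<tau> = transition_matrix Y (\<theta> * \<tau>) ** P"
  proof (rule transition_matrix_intertwine)
    fix b :: 'b and q :: "'a \<times> 'b"
    obtain a b' where q: "q = (a, b')"
      by fastforce
    have "(P ** adjacency_matrix (tensor_product X Y)) $ b $ q =
        (\<Sum>(a', b'')\<in>UNIV \<times> UNIV. if b'' = b
          then complex_of_real (x $ a') * of_bool (X a' a) * of_bool (Y b b') else 0)"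
      unfolding matrix_matrix_mult_def UNIV_Times_UNIV vec_lambda_beta
      by (rule sum.cong) (auto simp: q P_def adjacency_matrix_def tensor_product_def)
    also have "\<dots> = (\<Sum>a'\<in>UNIV. \<Sum>b''\<in>UNIV. if b'' = b
          then complex_of_real (x $ a') * of_bool (X a' a) * of_bool (Y b b') else 0)"
      by (rule sum.cartesian_product[symmetric])
    also have "\<dots> = (\<Sum>a'\<in>UNIV. complex_of_real (x $ a') * of_bool (X a' a) * of_bool (Y b b'))"
      by (subst sum.delta) simp_all
    also have "\<dots> = \<theta> * x $ a * of_bool (Y b b')"
      unfolding sum_distrib_right[symmetric] eigen_entry by simp
    finally have left: "(P ** adjacency_matrix (tensor_product X Y)) $ b $ q =
        \<theta> * x $ a * of_bool (Y b b')" .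
    have "(adjacency_matrix Y ** P) $ b $ q =
        (\<Sum>k\<in>UNIV. if k = b' then complex_of_real (x $ a) * of_bool (Y b b') else 0)"
      unfolding matrix_matrix_mult_def vec_lambda_beta
      by (rule sum.cong) (auto simp: q P_def adjacency_matrix_def)
    also have "\<dots> = x $ a * of_bool (Y b b')"
      by (subst sum.delta) simp_all
    finally have right: "(adjacency_matrix Y ** P) $ b $ q = x $ a * of_bool (Y b b')" .
    show "\<tau> * (P ** adjacency_matrix (tensor_product X Y)) $ b $ q =
        (\<theta> * \<tau>) * (adjacency_matrix Y ** P) $ b $ q"
      by (simp add: left right)
  qed
  then have "transition_matrix Y (\<theta> * \<tau>) *v (P *v axis (w, u) 1) = P *v (c *s axis (z, v) 1)"
    by (metis \<tau> matrix_vector_mul_assoc)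
  then have "of_real (x $ w) *s (transition_matrix Y (\<theta> * \<tau>) *v axis u 1) =
      (c * of_real (x $ z)) *s axis v 1"
    by (simp add: P_axis vector_scalar_commute)
  \<comment> \<open>The choice of \<open>x\<close> with \<open>x $ w\<close> nonzero permits this
    division; the quotient is the scalar of the transfer on \<open>Y\<close>.\<close>
  then have "transition_matrix Y (\<theta> * \<tau>) *v axis u 1 =
      (c * of_real (x $ z) / of_real (x $ w)) *s axis v 1"
    using xw by (simp add: vec_eq_iff field_simps)
  then show ?thesis
    using \<open>\<theta> \<noteq> 0\<close> \<open>\<tau> > 0\<close> by (intro state_transfer_cases) auto
qed

theorem theorem5:
  fixes X :: "'a::finite \<Rightarrow> 'a \<Rightarrow> bool" and Y :: "'b::finite \<Rightarrow> 'b \<Rightarrow> bool"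
    and w z :: 'a and u v :: 'b
  assumes "simple_graph X" and "simple_graph Y"
    and "perfect_state_transfer (tensor_product X Y) (w, u) (z, v)"
  shows "(u = v \<longrightarrow> periodic_at Y u) \<and>
         (u \<noteq> v \<longrightarrow> perfect_state_transfer Y u v) \<and>
         (w = z \<longrightarrow> periodic_at X w) \<and>
         (w \<noteq> z \<longrightarrow> perfect_state_transfer X w z)"
  using tensor_product_state_transfer_right[OF assms(1,3)]
    tensor_product_state_transfer_right[OF assms(2)
      perfect_state_transfer_tensor_product_swap[OF assms(3)]]
  by blast

end
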